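(* Let $a_0,a_1$ be elements of a commutative ring with unity and let $k\ge1$. Then for all $n\geqslant1$, \[ \operatorname{per}\bigl((a_0I_n+a_1P_n)\otimes J_k\bigr)=(k!)^n\sum_{l=0}^k\binom kl^n\bigl(a_0^{k-l}a_1^l\bigr)^n. \]
   Context: $P_n=(c_{i,j})_{1\le i,j\le n}$ with $c_{i,j}=1$ if $j-i\equiv1\pmod n$ and $0$ otherwise. $J_k$ is the $k\times k$ all-ones matrix, $\otimes$ the Kronecker product, $\operatorname{per}$ the permanent. *)

theory Defs
  imports "Jordan_Normal_Form.Matrix" "HOL-Combinatorics.Permutations" "HOL-Number_Theory.Cong"
begin

(* As for det, the value on non-square matrices is the junk value 0. *)
definition permanent :: "'a :: comm_ring_1 mat \<Rightarrow> 'a" where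
  "permanent A = (if dim_row A = dim_col A
     then (\<Sum>p \<in> {p. p permutes {0..<dim_row A}}. \<Prod>i = 0..<dim_row A. A $$ (i, p i))
     else 0)"

(* Block matrix whose (i, j) block, of the size of B, is A $$ (i, j) times B. *)
definition kronecker_product :: "'a :: comm_ring_1 mat \<Rightarrow> 'a mat \<Rightarrow> 'a mat" (infixl "\<otimes>\<^sub>K" 70) where
  "A \<otimes>\<^sub>K B = mat (dim_row A * dim_row B) (dim_col A * dim_col B)
     (\<lambda>(i, j). A $$ (i div dim_row B, j div dim_col B) * B $$ (i mod dim_row B, j mod dim_col B))"

definition all_ones_mat :: "nat \<Rightarrow> 'a :: comm_ring_1 mat" where
  "all_ones_mat k = mat k k (\<lambda>_. 1)"

(* Indices are 0-based; the condition depends only on the difference of the indices, so it is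
   the same for indices 1, ..., n. For n = 1 the congruence always holds and the matrix is (1). *)
definition cyclic_shift_mat :: "nat \<Rightarrow> 'a :: comm_ring_1 mat" where
  "cyclic_shift_mat n = mat n n (\<lambda>(i, j). if [int j - int i = 1] (mod int n) then 1 else 0)"

end

theory Submission
  imports Defs
begin

text \<open>Write the entry at \<open>(i, j)\<close> as a sum of an unshifted term with \<open>a0\<close> and a shifted term with
  \<open>a1\<close>, and expand the product over the rows. A summand is given by the set \<open>S\<close> of rows that use the
  shifted term; it prescribes for each row the block of its column. Permutations with prescribed
  blocks exist only if every block is prescribed exactly \<open>k\<close> times, and then there are \<open>(k!)\<^sup>n\<close> of
  them. The block following the block \<open>y\<close> is prescribed \<open>k\<close> times iff \<open>S\<close> meets both in equally many
  rows, so the contributing \<open>S\<close> are those that meet every block in the same number \<open>l\<close> of rows;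
  there are \<open>(k choose l)\<^sup>n\<close> of them for each \<open>l\<close>.\<close>

section \<open>Counting permutations with prescribed blocks\<close>

text \<open>Induction on \<open>X\<close>: a new point \<open>x\<close> takes any value in the fibre
  of \<open>f\<close> over \<open>g x\<close> that is still free, and the number of free values does
  not depend on the injection chosen so far. The codomain \<open>Z\<close> is kept apart from
  \<open>X\<close> so that it stays fixed while \<open>X\<close> grows. If a fibre is too small, one
  factor of the truncated falling factorial is 0, so the formula needs no case distinction.\<close>

lemma card_inj_prescribed:
  fixes f :: "'a \<Rightarrow> 'b" and g :: "'a \<Rightarrow> 'b"
  assumes "finite X" "finite Z" "finite Y" "g ` X \<subseteq> Y"
  defines "M \<equiv> \<lambda>X. {p. (\<forall>x. x \<notin> X \<longrightarrow> p x = x) \<and> inj_on p X \<and> p ` X \<subseteq> Z \<and> (\<forall>x\<in>X. f (p x) = g x)}"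
  shows "finite (M X) \<and> card (M X) =
    (\<Prod>y\<in>Y. \<Prod>i<card {x\<in>X. g x = y}. card {z\<in>Z. f z = y} - i)"
  using assms(1,4)
proof (induction X rule: finite_induct)
  case empty
  have "M {} = {id}" by (auto simp: M_def)
  then show ?case by simp
next
  case (insert x X)
  define F where "F = (\<lambda>y. {z\<in>Z. f z = y})"
  define G where "G = (\<lambda>y. {x\<in>X. g x = y})"
  \<comment> \<open>\<open>D\<close> pairs an injection on \<open>X\<close> with an admissible value
    at \<open>x\<close>, and \<open>h\<close> performs the extension; it turns out to be a bijection
    from \<open>D\<close> onto \<open>M (insert x X)\<close>.\<close>
  define D where "D = (SIGMA p:M X. F (g x) - p ` X)"
  define h where "h = (\<lambda>(p::'a \<Rightarrow> 'a, z). p(x := z))"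
  have finF: "finite (F y)" for y using assms(2) by (simp add: F_def)
  have finG: "finite (G y)" for y using insert.hyps(1) by (simp add: G_def)
  have IH: "finite (M X)" "card (M X) = (\<Prod>y\<in>Y. \<Prod>i<card (G y). card (F y) - i)"
    using insert by (auto simp: F_def G_def)
  have "M (insert x X) \<subseteq> h ` D"
  proof
    fix p assume p: "p \<in> M (insert x X)"
    \<comment> \<open>Resetting the value at \<open>x\<close> restores the normalisation that
      functions in \<open>M X\<close> are the identity off \<open>X\<close>.\<close>
    define q where "q = p(x := x)"
    have q: "q y = p y" if "y \<in> X" for y using that \<open>x \<notin> X\<close> by (auto simp: q_def)
    have px: "p x \<notin> p ` X" "p x \<in> F (g x)"
      using p \<open>x \<notin> X\<close> by (auto simp: M_def F_def)
    have "inj_on q X \<longleftrightarrow> inj_on p X" by (rule inj_on_cong) (rule q)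
    moreover have qX: "q ` X = p ` X" by (rule image_cong[OF refl q])
    moreover have "\<forall>y. y \<notin> X \<longrightarrow> q y = y" using p by (auto simp: q_def M_def)
    ultimately have "q \<in> M X"
      using p q by (simp add: M_def)
    then have "(q, p x) \<in> D"
      using px qX by (simp add: D_def)
    then show "p \<in> h ` D" by (rule rev_image_eqI) (simp add: h_def q_def)
  qed
  moreover have "h ` D \<subseteq> M (insert x X)"
  proof clarify
    fix p z assume "(p, z) \<in> D"
    then have p: "p \<in> M X" and z: "z \<in> F (g x)" "z \<notin> p ` X" by (auto simp: D_def)
    define q where "q = p(x := z)"
    have q: "q y = p y" if "y \<in> X" for y using that \<open>x \<notin> X\<close> by (auto simp: q_def)
    have "inj_on q X \<longleftrightarrow> inj_on p X" by (rule inj_on_cong) (rule q)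
    moreover have "q ` X = p ` X" by (rule image_cong[OF refl q])
    moreover have "\<forall>y. y \<notin> insert x X \<longrightarrow> q y = y" using p by (auto simp: q_def M_def)
    moreover have "q x = z" by (simp add: q_def)
    ultimately have "q \<in> M (insert x X)"
      using p z q \<open>x \<notin> X\<close> by (simp add: M_def F_def)
    then show "h (p, z) \<in> M (insert x X)" by (simp add: h_def q_def)
  qed
  ultimately have M_eq: "M (insert x X) = h ` D" by blast
  have inj: "inj_on h D"
  proof (rule inj_onI, clarify)
    fix p z q w assume pq: "(p, z) \<in> D" "(q, w) \<in> D" "h (p, z) = h (q, w)"
    then have "p x = x" "q x = x" using \<open>x \<notin> X\<close> by (auto simp: D_def M_def)
    then show "p = q \<and> z = w" using pq(3) unfolding h_def fun_eq_iff by (metis case_prod_conv fun_upd_apply)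
  qed
  \<comment> \<open>The values of \<open>p\<close> that fall into the fibre over \<open>g x\<close>
    are exactly the images of the points of \<open>G (g x)\<close>, and \<open>p\<close> is
    injective there.\<close>
  have c: "card (F (g x) - p ` X) = card (F (g x)) - card (G (g x))" if "p \<in> M X" for p
  proof -
    have "F (g x) - p ` X = F (g x) - p ` G (g x)" and "p ` G (g x) \<subseteq> F (g x)"
      using that by (auto simp: M_def F_def G_def)
    moreover have "inj_on p (G (g x))"
      using that by (auto simp: M_def G_def intro: inj_on_subset)
    ultimately show ?thesis
      using finG by (simp add: card_Diff_subset card_image)
  qed
  have "card (M (insert x X)) = (\<Sum>p\<in>M X. card (F (g x) - p ` X))"
    unfolding M_eq using inj finF IH(1) by (simp add: card_image D_def)
  also have "\<dots> = card (M X) * (card (F (g x)) - card (G (g x)))"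
    using c by simp
  \<comment> \<open>The factor for the new point is the next one, with
    \<open>i = card (G (g x))\<close>, in the falling factorial at \<open>y = g x\<close>.\<close>
  also have "\<dots> = (\<Prod>i<Suc (card (G (g x))). card (F (g x)) - i) *
      (\<Prod>y\<in>Y - {g x}. \<Prod>i<card (G y). card (F y) - i)"
    using IH(2) assms(3) insert.prems by (simp add: prod.remove[of Y "g x"])
  also have "Suc (card (G (g x))) = card {x'\<in>insert x X. g x' = g x}"
  proof -
    have "{x'\<in>insert x X. g x' = g x} = insert x (G (g x))" by (auto simp: G_def)
    then show ?thesis using finG \<open>x \<notin> X\<close> by (simp add: G_def)
  qed
  also have "(\<Prod>y\<in>Y - {g x}. \<Prod>i<card (G y). card (F y) - i) =
      (\<Prod>y\<in>Y - {g x}. \<Prod>i<card {x'\<in>insert x X. g x' = y}. card (F y) - i)"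
  proof (rule prod.cong[OF refl])
    fix y assume "y \<in> Y - {g x}"
    then have "{x'\<in>insert x X. g x' = y} = G y" by (auto simp: G_def)
    then show "(\<Prod>i<card (G y). card (F y) - i) =
        (\<Prod>i<card {x'\<in>insert x X. g x' = y}. card (F y) - i)" by simp
  qed
  finally have "card (M (insert x X)) = (\<Prod>y\<in>Y. \<Prod>i<card {x'\<in>insert x X. g x' = y}. card (F y) - i)"
    using assms(3) insert.prems by (simp add: prod.remove[of Y "g x"])
  moreover have "finite (M (insert x X))"
    unfolding M_eq D_def using IH(1) finF by auto
  ultimately show ?case by (simp add: F_def)
qed

text \<open>On the finite set \<open>X\<close>, injections into \<open>X\<close> are permutations.
  When the fibre sizes agree, each falling factorial is a full factorial.\<close>

lemma card_permutations_prescribed: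
  fixes f g :: "'a \<Rightarrow> 'b"
  assumes "finite X" "finite Y" "g ` X \<subseteq> Y"
  shows "card {p. p permutes X \<and> (\<forall>x\<in>X. f (p x) = g x)} =
    (if \<forall>y\<in>Y. card {x\<in>X. g x = y} = card {x\<in>X. f x = y}
     then \<Prod>y\<in>Y. fact (card {x\<in>X. f x = y}) else 0)"
proof (cases "\<forall>y\<in>Y. card {x\<in>X. g x = y} = card {x\<in>X. f x = y}")
  case True
  have "p permutes X \<longleftrightarrow> (\<forall>x. x \<notin> X \<longrightarrow> p x = x) \<and> inj_on p X \<and> p ` X \<subseteq> X" for p :: "'a \<Rightarrow> 'a"
    using assms(1) by (metis bij_betw_def bij_imp_permutes endo_inj_surj equalityD1
        permutes_imp_bij permutes_not_in)
  then have "card {p. p permutes X \<and> (\<forall>x\<in>X. f (p x) = g x)} =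
      (\<Prod>y\<in>Y. \<Prod>i<card {x\<in>X. g x = y}. card {x\<in>X. f x = y} - i)"
    using card_inj_prescribed[of X X Y g f] assms by (simp add: conj_assoc)
  also have "\<dots> = (\<Prod>y\<in>Y. fact (card {x\<in>X. f x = y}))"
    using True by (intro prod.cong) (auto simp: fact_prod_rev lessThan_atLeast0)
  finally show ?thesis using True by simp
next
  case False
  \<comment> \<open>Such a permutation maps the fibre of \<open>g\<close> over \<open>y\<close>
    bijectively onto that of \<open>f\<close>, so a single mismatch rules out all of them.\<close>
  have "card {x\<in>X. g x = y} = card {x\<in>X. f x = y}"
    if p: "p permutes X" "\<forall>x\<in>X. f (p x) = g x" for p y
  proof -
    have "p ` {x\<in>X. g x = y} = {x\<in>X. f x = y}"
    proof
      show "p ` {x\<in>X. g x = y} \<subseteq> {x\<in>X. f x = y}"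
        using p permutes_in_image[OF p(1)] by auto
      show "{x\<in>X. f x = y} \<subseteq> p ` {x\<in>X. g x = y}"
        using p permutes_image[OF p(1)] by force
    qed
    then show ?thesis
      using card_image[OF permutes_inj_on[OF p(1), of "{x\<in>X. g x = y}"]] by (simp only:)
  qed
  then have "\<not> (p permutes X \<and> (\<forall>x\<in>X. f (p x) = g x))" for p using False by metis
  then have none: "{p. p permutes X \<and> (\<forall>x\<in>X. f (p x) = g x)} = {}" by (simp only: simp_thms empty_def)
  show ?thesis unfolding none if_not_P[OF False] by simp
qed

section \<open>Subsets with equal traces on disjoint blocks\<close>

text \<open>A subset of a disjoint union is an independent choice of its traces on the members; the
  induction splits off one trace at a time.\<close>

lemma card_subsets_meeting_uniformly:
  assumes "finite I" "\<And>i. i \<in> I \<Longrightarrow> finite (B i)" "disjoint_family_on B I"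
  shows "card {S. S \<subseteq> (\<Union>i\<in>I. B i) \<and> (\<forall>i\<in>I. card (S \<inter> B i) = l)} = (\<Prod>i\<in>I. card (B i) choose l)"
  using assms
proof (induction I rule: finite_induct)
  case empty
  have "{S. S = {}} = {{}}" by auto
  then show ?case by simp
next
  case (insert j I)
  define U where "U = (\<Union>i\<in>I. B i)"
  define N where "N = {S. S \<subseteq> U \<and> (\<forall>i\<in>I. card (S \<inter> B i) = l)}"
  define K where "K = {T. T \<subseteq> B j \<and> card T = l}"
  have disj: "U \<inter> B j = {}"
    using insert.prems(2) insert.hyps(2) by (auto simp: U_def disjoint_family_on_def disjoint_iff)
  have "disjoint_family_on B I"
    using insert.prems(2) by (auto simp: disjoint_family_on_def)
  then have IH: "card N = (\<Prod>i\<in>I. card (B i) choose l)"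
    unfolding N_def U_def using insert by simp
  have "{S. S \<subseteq> (\<Union>i\<in>insert j I. B i) \<and> (\<forall>i\<in>insert j I. card (S \<inter> B i) = l)} =
      (\<lambda>(T, S). T \<union> S) ` (K \<times> N)" (is "?L = ?R")
  proof
    show "?L \<subseteq> ?R"
    proof
      fix S assume S: "S \<in> ?L"
      have "(S \<inter> U) \<inter> B i = S \<inter> B i" if "i \<in> I" for i using that by (auto simp: U_def)
      then have "(S \<inter> B j, S \<inter> U) \<in> K \<times> N" using S by (auto simp: K_def N_def)
      moreover have "S = (S \<inter> B j) \<union> (S \<inter> U)" using S by (auto simp: U_def)
      ultimately show "S \<in> ?R" by (intro rev_image_eqI) auto
    qed
    show "?R \<subseteq> ?L"
    proof clarify
      fix T S assume TS: "T \<in> K" "S \<in> N"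
      then have "(T \<union> S) \<inter> B j = T" using disj by (auto simp: K_def N_def)
      moreover have "(T \<union> S) \<inter> B i = S \<inter> B i" if "i \<in> I" for i
        using TS that disj by (auto simp: K_def N_def U_def)
      ultimately show "T \<union> S \<subseteq> (\<Union>i\<in>insert j I. B i) \<and> (\<forall>i\<in>insert j I. card ((T \<union> S) \<inter> B i) = l)"
        using TS by (auto simp: K_def N_def U_def)
    qed
  qed
  moreover have "inj_on (\<lambda>(T, S). T \<union> S) (K \<times> N)"
  proof (rule inj_on_inverseI[where g = "\<lambda>V. (V \<inter> B j, V \<inter> U)"])
    fix V assume "V \<in> K \<times> N"
    then obtain T S where V: "V = (T, S)" "T \<subseteq> B j" "S \<subseteq> U" by (auto simp: K_def N_def)
    then have "(T \<union> S) \<inter> B j = T" "(T \<union> S) \<inter> U = S" using disj by auto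
    then show "((case V of (T, S) \<Rightarrow> T \<union> S) \<inter> B j, (case V of (T, S) \<Rightarrow> T \<union> S) \<inter> U) = V"
      using V(1) by simp
  qed
  moreover have "card K = card (B j) choose l"
    unfolding K_def using insert.prems(1) by (simp add: n_subsets)
  ultimately show ?case
    using insert.hyps IH by (simp add: card_image card_cartesian_product)
qed

section \<open>Blocks of indices and the cyclic successor\<close>

lemma card_div_eq:
  assumes "y < n"
  shows "card {i\<in>{0..<n * k}. i div k = y} = (k::nat)"
proof (cases "k = 0")
  case False
  have iff: "i div k = y \<longleftrightarrow> i \<in> {y * k..<Suc y * k}" for i
    using False div_less_iff_less_mult[of k i "Suc y"] less_eq_div_iff_mult_less_eq[of k y i] by auto
  have "Suc y * k \<le> n * k" using assms by (intro mult_le_mono1) simp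
  then have "{y * k..<Suc y * k} \<subseteq> {0..<n * k}" by (simp only: ivl_subset zero_le simp_thms)
  then have "{i\<in>{0..<n * k}. i div k = y} = {y * k..<Suc y * k}" unfolding iff by blast
  then show ?thesis by (simp only: card_atLeastLessThan mult_Suc add_diff_cancel_right')
qed simp

lemma prod_if_zero:
  fixes c :: "'a :: comm_semiring_1"
  assumes "finite S"
  shows "(\<Prod>i\<in>S. if P i then c else 0) = (if \<forall>i\<in>S. P i then c ^ card S else 0)"
  using assms by (induction S rule: finite_induct) auto

lemma inj_on_Suc_mod: "inj_on (\<lambda>y. Suc y mod n) {..<n}"
proof (rule inj_onI)
  fix x y assume "x \<in> {..<n}" "y \<in> {..<n}" "Suc x mod n = Suc y mod n"
  then show "x = y" by (auto simp: mod_Suc split: if_splits)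
qed

text \<open>The cyclic successor is an injective self-map of a finite set, hence onto, so a
  statement about all blocks may be reindexed along it.\<close>

lemma ball_lessThan_Suc_mod: "(\<forall>y<n. P (Suc y mod n)) \<longleftrightarrow> (\<forall>y<n. P y)"
proof -
  have "(\<lambda>y. Suc y mod n) ` {..<n} = {..<n}"
    by (intro endo_inj_surj inj_on_Suc_mod) auto
  then show ?thesis by (metis (no_types, lifting) imageE image_eqI lessThan_iff)
qed

lemma cyclic_invariant_iff_const:
  assumes "n \<ge> 1"
  shows "(\<forall>y<n. s (Suc y mod n) = s y) \<longleftrightarrow> (\<forall>y<n. s y = s 0)"
proof
  assume inv: "\<forall>y<n. s (Suc y mod n) = s y"
  have "s y = s 0" if "y < n" for y
    using that
  proof (induction y)
    case (Suc y)
    then show ?case using inv by (metis Suc_lessD mod_less)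
  qed simp
  then show "\<forall>y<n. s y = s 0" by blast
next
  assume const: "\<forall>y<n. s y = s 0"
  have "Suc y mod n < n" for y using assms by simp
  then show "\<forall>y<n. s (Suc y mod n) = s y"
    using const by metis
qed

text \<open>Turns the integer congruence in \<open>cyclic_shift_mat\<close> into the cyclic
  successor on naturals; for \<open>n = 1\<close> both sides hold.\<close>

lemma cong_shift_iff:
  assumes "x < n" "y < n"
  shows "[int y - int x = 1] (mod int n) \<longleftrightarrow> y = Suc x mod n"
proof -
  have "[int y - int x = 1] (mod int n) \<longleftrightarrow> [int y = int (Suc x)] (mod int n)"
    by (simp add: cong_iff_dvd_diff algebra_simps)
  also have "\<dots> \<longleftrightarrow> y = Suc x mod n"
    using assms unfolding cong_int_iff by (simp add: cong_def)
  finally show ?thesis .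
qed

section \<open>Expansion and evaluation of the permanent\<close>

theorem theorem4:
  fixes a0 a1 :: "'a :: comm_ring_1" and k n :: nat
  assumes "k \<ge> 1" and "n \<ge> 1"
  shows "permanent ((a0 \<cdot>\<^sub>m 1\<^sub>m n + a1 \<cdot>\<^sub>m cyclic_shift_mat n) \<otimes>\<^sub>K all_ones_mat k) =
    of_nat (fact k) ^ n * (\<Sum>l = 0..k. of_nat (k choose l) ^ n * (a0 ^ (k - l) * a1 ^ l) ^ n)"
proof -
  define M where "M = (a0 \<cdot>\<^sub>m 1\<^sub>m n + a1 \<cdot>\<^sub>m cyclic_shift_mat n) \<otimes>\<^sub>K all_ones_mat k"
  define X where "X = {0..<n * k}"
  define B where "B = (\<lambda>y. {i\<in>X. i div k = y})"
  \<comment> \<open>\<open>G S i\<close> is the block prescribed for the column of row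
    \<open>i\<close>, and \<open>w S\<close> below is the product of the coefficients picked by
    \<open>S\<close>.\<close>
  define G where "G = (\<lambda>S i. if i \<in> S then Suc (i div k) mod n else i div k)"
  define A where "A = (\<lambda>l. {S. S \<subseteq> X \<and> (\<forall>y\<in>{..<n}. card (S \<inter> B y) = l)})"
  define w where "w = (\<lambda>S :: nat set. a1 ^ card S * a0 ^ card (X - S))"
  have finX: "finite X" and finB: "finite (B y)" for y by (auto simp: X_def B_def)
  have cardB: "card (B y) = k" if "y < n" for y
    using card_div_eq[OF that] by (simp add: B_def X_def)
  have div_lt: "i div k < n" if "i \<in> X" for i
    using that by (simp add: X_def less_mult_imp_div_less)
  have UB: "(\<Union>y\<in>{..<n}. B y) = X" using div_lt by (auto simp: B_def)
  have disj: "disjoint_family_on B {..<n}" by (auto simp: disjoint_family_on_def B_def)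

  \<comment> \<open>A sum of two conditionals, since both conditions hold at once when
    \<open>n = 1\<close>.\<close>
  have entry: "M $$ (i, j) = (if j div k = Suc (i div k) mod n then a1 else 0) +
      (if j div k = i div k then a0 else 0)" if "i \<in> X" "j \<in> X" for i j
    using that div_lt[OF that(1)] div_lt[OF that(2)] assms(1)
    by (auto simp: M_def X_def kronecker_product_def all_ones_mat_def cyclic_shift_mat_def
        cong_shift_iff)
  have expand: "(\<Prod>i\<in>X. M $$ (i, p i)) =
      (\<Sum>S\<in>Pow X. if \<forall>i\<in>X. p i div k = G S i then w S else 0)" if p: "p permutes X" for p
  proof -
    have "(\<Prod>i\<in>X. M $$ (i, p i)) = (\<Prod>i\<in>X. (if p i div k = Suc (i div k) mod n then a1 else 0) +
        (if p i div k = i div k then a0 else 0))"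
      using entry permutes_in_image[OF p] by (intro prod.cong) auto
    also have "\<dots> = (\<Sum>S\<in>Pow X. if \<forall>i\<in>X. p i div k = G S i then w S else 0)"
      unfolding prod_add[OF finX]
    proof (rule sum.cong[OF refl])
      fix S assume "S \<in> Pow X"
      then have "S \<subseteq> X" "finite S" using finX finite_subset by auto
      moreover have "(\<forall>i\<in>X. p i div k = G S i) \<longleftrightarrow>
          (\<forall>i\<in>S. p i div k = Suc (i div k) mod n) \<and> (\<forall>i\<in>X - S. p i div k = i div k)"
        using \<open>S \<subseteq> X\<close> by (auto simp: G_def)
      ultimately show "(\<Prod>i\<in>S. if p i div k = Suc (i div k) mod n then a1 else 0) *
          (\<Prod>i\<in>X - S. if p i div k = i div k then a0 else 0) =
          (if \<forall>i\<in>X. p i div k = G S i then w S else 0)"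
        using finX by (simp add: prod_if_zero w_def)
    qed
    finally show ?thesis .
  qed

  have balanced: "(\<forall>y<n. card {i\<in>X. G S i = y} = k) \<longleftrightarrow> S \<in> (\<Union>l\<in>{0..k}. A l)" if S: "S \<subseteq> X" for S
  proof -
    have le: "card (S \<inter> B y) \<le> k" if "y < n" for y
      using card_mono[OF finB, of "S \<inter> B y" y] cardB[OF that] by simp
    have c: "card {i\<in>X. G S i = Suc y mod n} = card (S \<inter> B y) + (k - card (S \<inter> B (Suc y mod n)))"
      if y: "y < n" for y
    proof -
      have "Suc (i div k) mod n = Suc y mod n \<longleftrightarrow> i div k = y" if "i \<in> X" for i
        using inj_on_eq_iff[OF inj_on_Suc_mod, of "i div k" n y] div_lt[OF that] y by simp
      \<comment> \<open>Shifted rows come from block \<open>y\<close>, unshifted ones from its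
        successor. The two parts are disjoint even for \<open>n = 1\<close>, as one lies inside
        \<open>S\<close> and the other outside.\<close>
      then have "{i\<in>X. G S i = Suc y mod n} = (S \<inter> B y) \<union> (B (Suc y mod n) - S \<inter> B (Suc y mod n))"
        using S by (auto simp: G_def B_def)
      moreover have "card (B (Suc y mod n) - S \<inter> B (Suc y mod n)) = k - card (S \<inter> B (Suc y mod n))"
        using finB assms(2) by (simp add: card_Diff_subset cardB)
      ultimately show ?thesis
        using finB by (simp add: card_Un_disjoint disjoint_iff)
    qed
    have "(\<forall>y<n. card {i\<in>X. G S i = y} = k) \<longleftrightarrow> (\<forall>y<n. card {i\<in>X. G S i = Suc y mod n} = k)"
      by (rule ball_lessThan_Suc_mod[symmetric])
    also have "\<dots> \<longleftrightarrow> (\<forall>y<n. card (S \<inter> B (Suc y mod n)) = card (S \<inter> B y))"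
    proof -
      have "card {i\<in>X. G S i = Suc y mod n} = k \<longleftrightarrow> card (S \<inter> B (Suc y mod n)) = card (S \<inter> B y)"
        if "y < n" for y
        \<comment> \<open>The bound by \<open>k\<close> makes the truncated subtraction in
          \<open>c\<close> a true one.\<close>
        using le[of "Suc y mod n"] le[OF that] assms(2) unfolding c[OF that] by auto
      then show ?thesis by blast
    qed
    also have "\<dots> \<longleftrightarrow> (\<forall>y<n. card (S \<inter> B y) = card (S \<inter> B 0))"
      by (rule cyclic_invariant_iff_const[OF assms(2)])
    also have "\<dots> \<longleftrightarrow> S \<in> (\<Union>l\<in>{0..k}. A l)"
    proof
      assume "\<forall>y<n. card (S \<inter> B y) = card (S \<inter> B 0)"
      then have "S \<in> A (card (S \<inter> B 0))" using S unfolding A_def by blast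
      then show "S \<in> (\<Union>l\<in>{0..k}. A l)" using le[of 0] assms(2) by auto
    next
      assume "S \<in> (\<Union>l\<in>{0..k}. A l)"
      then show "\<forall>y<n. card (S \<inter> B y) = card (S \<inter> B 0)" using assms(2) by (auto simp: A_def)
    qed
    finally show ?thesis .
  qed

  have count: "card {p. p permutes X \<and> (\<forall>i\<in>X. p i div k = G S i)} =
      (if S \<in> (\<Union>l\<in>{0..k}. A l) then fact k ^ n else 0)" if S: "S \<subseteq> X" for S
  proof -
    have "G S ` X \<subseteq> {..<n}" using div_lt assms(2) by (auto simp: G_def)
    then have "card {p. p permutes X \<and> (\<forall>i\<in>X. p i div k = G S i)} =
        (if \<forall>y\<in>{..<n}. card {i\<in>X. G S i = y} = card (B y) then \<Prod>y\<in>{..<n}. fact (card (B y)) else 0)"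
      unfolding B_def by (intro card_permutations_prescribed finX) auto
    also have "(\<forall>y\<in>{..<n}. card {i\<in>X. G S i = y} = card (B y)) \<longleftrightarrow> S \<in> (\<Union>l\<in>{0..k}. A l)"
      unfolding balanced[OF S, symmetric] using cardB by auto
    also have "(\<Prod>y\<in>{..<n}. fact (card (B y))) = (fact k ^ n :: nat)"
      using cardB by simp
    finally show ?thesis .
  qed

  have w_A: "w S = (a0 ^ (k - l) * a1 ^ l) ^ n" if S: "S \<in> A l" and "l \<le> k" for S l
  proof -
    have "S = (\<Union>y\<in>{..<n}. S \<inter> B y)" using S UB by (auto simp: A_def)
    then have "card S = card (\<Union>y\<in>{..<n}. S \<inter> B y)" by simp
    also have "\<dots> = (\<Sum>y\<in>{..<n}. card (S \<inter> B y))"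
      using disj finB by (intro card_UN_disjoint) (auto simp: disjoint_family_on_def)
    also have "\<dots> = l * n" using S by (simp add: A_def)
    finally have "card S = l * n" .
    moreover have "card (X - S) = (k - l) * n"
    proof -
      have "S \<subseteq> X" using S by (simp add: A_def)
      then have "card (X - S) = n * k - l * n"
        using finite_subset[OF _ finX] \<open>card S = l * n\<close> by (simp add: card_Diff_subset X_def)
      then show ?thesis by (simp add: diff_mult_distrib mult.commute[of n k])
    qed
    ultimately show ?thesis
      by (simp only: w_def power_mult power_mult_distrib
          mult.commute[of "(a1 ^ l) ^ n" "(a0 ^ (k - l)) ^ n"])
  qed
  have card_A: "card (A l) = (k choose l) ^ n" for l
    using card_subsets_meeting_uniformly[of "{..<n}" B l] finB disj cardB
    unfolding UB A_def by simp
  have A_sub: "A l \<subseteq> Pow X" for l by (auto simp: A_def)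
  \<comment> \<open>As \<open>n\<close> is positive, block 0 exists, and its intersection with
    \<open>S\<close> determines \<open>l\<close>.\<close>
  have A_disj: "A l \<inter> A m = {}" if "l \<noteq> m" for l m
    using that assms(2) by (auto simp: A_def Ball_def dest: spec[of _ 0])

  have dim: "dim_row M = n * k" "dim_col M = n * k"
    by (simp_all add: M_def kronecker_product_def all_ones_mat_def cyclic_shift_mat_def)
  have "permanent M = (\<Sum>p | p permutes X. \<Prod>i\<in>X. M $$ (i, p i))"
    by (simp add: permanent_def dim X_def)
  also have "\<dots> = (\<Sum>p | p permutes X. \<Sum>S\<in>Pow X. if \<forall>i\<in>X. p i div k = G S i then w S else 0)"
    using expand by (intro sum.cong) auto
  \<comment> \<open>For fixed \<open>S\<close> the weight \<open>w S\<close> is constant, so the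
    inner sum becomes a count of permutations.\<close>
  also have "\<dots> = (\<Sum>S\<in>Pow X. \<Sum>p | p permutes X. if \<forall>i\<in>X. p i div k = G S i then w S else 0)"
    by (rule sum.swap)
  also have "\<dots> = (\<Sum>S\<in>Pow X. of_nat (card {p. p permutes X \<and> (\<forall>i\<in>X. p i div k = G S i)}) * w S)"
    using finite_permutations[OF finX] by (simp add: sum.If_cases Int_def)
  also have "\<dots> = (\<Sum>S\<in>Pow X. if S \<in> (\<Union>l\<in>{0..k}. A l) then of_nat (fact k) ^ n * w S else 0)"
    using count by (intro sum.cong) auto
  also have "\<dots> = (\<Sum>S\<in>(\<Union>l\<in>{0..k}. A l). of_nat (fact k) ^ n * w S)"
    using A_sub finX by (intro sum.mono_neutral_cong_right) auto
  also have "\<dots> = (\<Sum>l=0..k. \<Sum>S\<in>A l. of_nat (fact k) ^ n * w S)"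
    using A_disj finite_subset[OF A_sub] finX by (intro sum.UNION_disjoint) auto
  also have "\<dots> = (\<Sum>l=0..k. of_nat (fact k) ^ n * (of_nat (k choose l) ^ n * (a0 ^ (k - l) * a1 ^ l) ^ n))"
    using w_A card_A by (intro sum.cong) (auto simp: mult_ac)
  finally show ?thesis by (simp add: M_def sum_distrib_left)
qed

end
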